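(* Let $\mathcal{A}=(Q,\delta,\Sigma,s)$ be an NFA, and let $\leq_{R}$ and $\leq_{FS}$ be the maximum co-lex relation and the coarsest forward-stable co-lex (CFS) order of $\mathcal{A}$, respectively. Let $\sim_R$ and $\sim_{FS}$ be the equivalence relations on $Q$ induced by $\leq_R$ and $\leq_{FS}$, and let $\mathcal{A}/_{\sim_{R}}$ and $\mathcal{A}/_{\sim_{FS}}$ be the corresponding quotient automata, with state sets $Q/_{\sim_R}$ and $Q/_{\sim_{FS}}$. Then: 1. $\leq_{FS}$ is an indexable partial preorder for $\mathcal{A}$. 2. The co-lexicographic width of $\mathcal{A}/_{\sim_{FS}}$ is smaller than or equal to the co-lexicographic width of $\mathcal{A}/_{\sim_{R}}$. 3. The number of parts in the partition $Q/_{\sim_{FS}}$ is smaller than or equal to the number of parts in the partition $Q/_{\sim_{R}}$.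
   Context: NFA: a tuple $(Q,\delta,\Sigma,s)$ with finite state set $Q$, finite alphabet $\Sigma$, transition function $\delta:Q\times\Sigma\to 2^Q$ and initial state $s\in Q$ (no set of final states). Standing assumptions: every state is reachable from $s$; $s$ has no incoming edges; every character of $\Sigma$ labels at least one transition. Write $\delta_a(u)=\delta(u,a)$ and $\delta_a(S)=\bigcup_{u\in S}\delta_a(u)$ for $S\subseteq Q$; $\delta$ is extended to strings as usual. $I_u=\{\alpha\in\Sigma^*: u\in\delta(s,\alpha)\}$; the language accepted by $\mathcal{A}$ is $\bigcup_{u\in Q}I_u$. The set $\Sigma\cup\{\#\}$ ($\#\notin\Sigma$) carries a fixed total order with $\#<a$ for all $a\in\Sigma$. For $u\ne s$, $\lambda(u)\subseteq\Sigma$ is the set of labels of edges entering $u$; $\lambda(s)=\{\#\}$. $\lambda(u)\le\lambda(v)$ means $a\le a'$ for all $a\in\lambda(u)$, $a'\in\lambda(v)$. Forward-stability: for $S,T\subseteq Q$, $S$ is forward-stable w.r.t. $T$ if for every $a\in\Sigma$ either $S\subseteq\delta_a(T)$ or $S\cap\delta_a(T)=\emptyset$. A partition of $Q$ is forward-stable for $\mathcal{A}$ if each part is forward-stable w.r.t. each part. The coarsest forward-stable partition is the unique forward-stable partition of which every forward-stable partition is a refinement (it always exists). A partial preorder is a reflexive transitive relation; it induces the equivalence $u\sim v\iff u\le v$ and $v\le u$, and the partial order $[u]_\sim\le'[v]_\sim\iff u\le v$ on the set of classes. For a partial order or preorder, $u<v$ means $u\le v$ and not $v\le u$; an antichain is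 a set in which no two distinct elements $u,v$ satisfy $u\le v$ or $v\le u$; the width is the size of a largest antichain. Quotient automaton: for an equivalence relation $\sim$ on $Q$, $\mathcal{A}/_\sim=(Q/_\sim,\delta/_\sim,\Sigma,[s]_\sim)$, where $[v]_\sim\in\delta/_\sim([u]_\sim,a)$ iff there are $u'\in[u]_\sim$, $v'\in[v]_\sim$ with $v'\in\delta(u',a)$. Co-lex order of $\mathcal{A}$: a partial order $\le$ on $Q$ such that (1) $u<v$ implies $\lambda(u)\le\lambda(v)$; (2) whenever $u\in\delta_a(u')$, $v\in\delta_a(v')$ and $u<v$, then $u'\le v'$. The maximum co-lex order, if it exists, is a co-lex order equal to the union of all co-lex orders. The co-lexicographic width of $\mathcal{A}$ is the smallest width of a co-lex order of $\mathcal{A}$. Co-lex relation of $\mathcal{A}$: a reflexive relation $R$ on $Q$ such that (1) for $u\ne v$, $(u,v)\in R$ implies $\lambda(u)\le\lambda(v)$; (2) for $u\in\delta_a(u')$, $v\in\delta_a(v')$ with $u\neq v$, $(u,v)\in R$ implies $(u',v')\in R$. The maximum co-lex relation $\le_R$ is the union of all co-lex relations; it is itself a co-lex relation and a partial preorder. CFS order: let $\approx$ be the equivalence on $Q$ whose classes are the parts of the coarsest forward-stable partition for $\mathcal{A}$. The quotient $\mathcal{A}/_{\approx}$ always admits a maximum co-lex order $\le$, and the CFS order $\le_{FS}$ is defined by $u\le_{FS}v\iff[u]_{\approx}\le[v]_{\approx}$. It is a partial preorder whose induced equivalence $\sim_{FS}$ equals $\approx$. Indexable partial preorder: for an NFA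 $\mathcal{A}$ of co-lexicographic width $\bar p$, a partial preorder $\le$ on $Q$ with induced equivalence $\sim$ is indexable for $\mathcal{A}$ if (1) $\mathcal{A}$ and $\mathcal{A}/_\sim$ accept the same language; (2) $\mathcal{A}/_\sim$ has co-lexicographic width $\bar q$ with $\bar q\le\bar p$; (3) the partial order on $Q/_\sim$ induced by $\le$ is a co-lex order of $\mathcal{A}/_\sim$ of width $\bar q$. *)

theory Defs
  imports "HOL-Library.Option_ord" "HOL-Library.Disjoint_Sets"
begin

text \<open>
  The alphabet is a finite subset of a linearly ordered type. The additional character
  \<open>#\<close> is \<^term>\<open>None\<close>, an ordinary character \<open>a\<close> is \<^term>\<open>Some a\<close>; the order of
  \<open>Option_ord\<close> makes \<^term>\<open>None\<close> smaller than all of them. Values of \<open>delta\<close> outside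
  \<open>states \<times> alphabet\<close> are irrelevant.
\<close>

record ('q, 'a) pre_nfa =
  states :: "'q set"
  delta :: "'q \<Rightarrow> 'a \<Rightarrow> 'q set"
  alphabet :: "'a set"
  start :: 'q

definition step :: "('q, 'a) pre_nfa \<Rightarrow> 'a \<Rightarrow> 'q set \<Rightarrow> 'q set" where
  "step A a S = (\<Union>u\<in>S. delta A u a)"

definition reach :: "('q, 'a) pre_nfa \<Rightarrow> 'q \<Rightarrow> 'a list \<Rightarrow> 'q set" where
  "reach A u w = fold (step A) w {u}"

definition words_to :: "('q, 'a) pre_nfa \<Rightarrow> 'q \<Rightarrow> 'a list set" where
  "words_to A u = {w \<in> lists (alphabet A). u \<in> reach A (start A) w}"

definition language :: "('q, 'a) pre_nfa \<Rightarrow> 'a list set" where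
  "language A = (\<Union>u\<in>states A. words_to A u)"

locale nfa =
  fixes A :: "('q, 'a::linorder) pre_nfa"
  assumes finite_states: "finite (states A)"
    and finite_alphabet: "finite (alphabet A)"
    and start_in_states: "start A \<in> states A"
    and delta_closed: "\<lbrakk>u \<in> states A; a \<in> alphabet A\<rbrakk> \<Longrightarrow> delta A u a \<subseteq> states A"
    and all_reachable: "u \<in> states A \<Longrightarrow> words_to A u \<noteq> {}"
    and start_no_incoming: "\<lbrakk>u \<in> states A; a \<in> alphabet A\<rbrakk> \<Longrightarrow> start A \<notin> delta A u a"
    and alphabet_used: "a \<in> alphabet A \<Longrightarrow> \<exists>u\<in>states A. delta A u a \<noteq> {}"

definition labels :: "('q, 'a) pre_nfa \<Rightarrow> 'q \<Rightarrow> 'a option set" where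
  "labels A u =
     (if u = start A then {None}
      else Some ` {a \<in> alphabet A. \<exists>u'\<in>states A. u \<in> delta A u' a})"

definition labels_le :: "('q, 'a::linorder) pre_nfa \<Rightarrow> 'q \<Rightarrow> 'q \<Rightarrow> bool" where
  "labels_le A u v \<longleftrightarrow> (\<forall>a\<in>labels A u. \<forall>b\<in>labels A v. a \<le> b)"

definition quotient_nfa :: "('q, 'a) pre_nfa \<Rightarrow> 'q rel \<Rightarrow> ('q set, 'a) pre_nfa" where
  "quotient_nfa A E =
     \<lparr>states = states A // E,
      delta = (\<lambda>U a. {V \<in> states A // E. \<exists>u\<in>U. \<exists>v\<in>V. v \<in> delta A u a}),
      alphabet = alphabet A,
      start = E `` {start A}\<rparr>"

definition induced_equiv :: "'q rel \<Rightarrow> 'q rel" where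
  "induced_equiv r = r \<inter> r\<inverse>"

definition induced_order :: "'q rel \<Rightarrow> 'q set rel" where
  "induced_order r = {(induced_equiv r `` {u}, induced_equiv r `` {v}) | u v. (u, v) \<in> r}"

definition antichain :: "'q rel \<Rightarrow> 'q set \<Rightarrow> bool" where
  "antichain r S \<longleftrightarrow> (\<forall>u\<in>S. \<forall>v\<in>S. u \<noteq> v \<longrightarrow> (u, v) \<notin> r \<and> (v, u) \<notin> r)"

definition width :: "'q set \<Rightarrow> 'q rel \<Rightarrow> nat" where
  "width X r = Max (card ` {S. S \<subseteq> X \<and> antichain r S})"

definition colex_order :: "('q, 'a::linorder) pre_nfa \<Rightarrow> 'q rel \<Rightarrow> bool" where
  "colex_order A r \<longleftrightarrow>
     partial_order_on (states A) r \<and>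
     (\<forall>u v. (u, v) \<in> r \<and> (v, u) \<notin> r \<longrightarrow> labels_le A u v) \<and>
     (\<forall>a\<in>alphabet A. \<forall>u'\<in>states A. \<forall>v'\<in>states A. \<forall>u\<in>delta A u' a. \<forall>v\<in>delta A v' a.
        (u, v) \<in> r \<and> (v, u) \<notin> r \<longrightarrow> (u', v') \<in> r)"

definition is_max_colex_order :: "('q, 'a::linorder) pre_nfa \<Rightarrow> 'q rel \<Rightarrow> bool" where
  "is_max_colex_order A r \<longleftrightarrow> colex_order A r \<and> r = \<Union> {r'. colex_order A r'}"

text \<open>Unspecified if there is no maximum co-lex order.\<close>

definition max_colex_order :: "('q, 'a::linorder) pre_nfa \<Rightarrow> 'q rel" where
  "max_colex_order A = (THE r. is_max_colex_order A r)"

definition colex_width :: "('q, 'a::linorder) pre_nfa \<Rightarrow> nat" where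
  "colex_width A = (LEAST w. \<exists>r. colex_order A r \<and> w = width (states A) r)"

definition colex_relation :: "('q, 'a::linorder) pre_nfa \<Rightarrow> 'q rel \<Rightarrow> bool" where
  "colex_relation A R \<longleftrightarrow>
     R \<subseteq> states A \<times> states A \<and> refl_on (states A) R \<and>
     (\<forall>u v. u \<noteq> v \<and> (u, v) \<in> R \<longrightarrow> labels_le A u v) \<and>
     (\<forall>a\<in>alphabet A. \<forall>u'\<in>states A. \<forall>v'\<in>states A. \<forall>u\<in>delta A u' a. \<forall>v\<in>delta A v' a.
        u \<noteq> v \<and> (u, v) \<in> R \<longrightarrow> (u', v') \<in> R)"

definition max_colex_relation :: "('q, 'a::linorder) pre_nfa \<Rightarrow> 'q rel" where
  "max_colex_relation A = \<Union> {R. colex_relation A R}"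

definition forward_stable :: "('q, 'a) pre_nfa \<Rightarrow> 'q set \<Rightarrow> 'q set \<Rightarrow> bool" where
  "forward_stable A S T \<longleftrightarrow>
     (\<forall>a\<in>alphabet A. S \<subseteq> step A a T \<or> S \<inter> step A a T = {})"

definition forward_stable_partition :: "('q, 'a) pre_nfa \<Rightarrow> 'q set set \<Rightarrow> bool" where
  "forward_stable_partition A P \<longleftrightarrow>
     partition_on (states A) P \<and> (\<forall>S\<in>P. \<forall>T\<in>P. forward_stable A S T)"

definition coarsest_fs_partition :: "('q, 'a) pre_nfa \<Rightarrow> 'q set set" where
  "coarsest_fs_partition A =
     (THE P. forward_stable_partition A P \<and>
        (\<forall>P'. forward_stable_partition A P' \<longrightarrow> refines (states A) P' P))"

definition fs_equiv :: "('q, 'a) pre_nfa \<Rightarrow> 'q rel" where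
  "fs_equiv A = {(u, v). \<exists>S\<in>coarsest_fs_partition A. u \<in> S \<and> v \<in> S}"

definition cfs_order :: "('q, 'a::linorder) pre_nfa \<Rightarrow> 'q rel" where
  "cfs_order A =
     {(u, v). u \<in> states A \<and> v \<in> states A \<and>
        (fs_equiv A `` {u}, fs_equiv A `` {v}) \<in> max_colex_order (quotient_nfa A (fs_equiv A))}"

definition indexable :: "('q, 'a::linorder) pre_nfa \<Rightarrow> 'q rel \<Rightarrow> bool" where
  "indexable A r \<longleftrightarrow>
     preorder_on (states A) r \<and>
     (let B = quotient_nfa A (induced_equiv r) in
        language A = language B \<and>
        colex_width B \<le> colex_width A \<and>
        colex_order B (induced_order r) \<and>
        width (states B) (induced_order r) = colex_width B)"

end

theory Submission
  imports Defs
begin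

text \<open>
  A symmetric backward bisimulation on the states lies inside the coarsest forward-stable
  equivalence. The equivalence induced by the maximum co-lex relation is such a bisimulation, which
  gives the third claim. Bisimulations of the quotient by the coarsest one lift back to the original
  automaton, so on this quotient the maximum co-lex relation is antisymmetric and therefore the
  maximum co-lex order, and its width is the co-lex width of the quotient. Finally, a map of automata
  whose incoming edges lift carries co-lex relations forward, so it cannot increase the co-lex
  width; this applies to the maps from the original automaton and from its quotient by the maximum
  co-lex relation onto the forward-stable quotient.
\<close>

section \<open>Backward bisimulations and the coarsest forward-stable partition\<close>

text \<open>Edges are matched backwards, from targets to sources. Symmetry is the only closure
  property demanded, so that any union of bisimulations is again one.\<close>

definition bisim :: "('q, 'a) pre_nfa \<Rightarrow> 'q rel \<Rightarrow> bool" where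
  "bisim A E \<longleftrightarrow> E \<subseteq> states A \<times> states A \<and> sym E \<and>
     (\<forall>u v a u'. (u, v) \<in> E \<and> a \<in> alphabet A \<and> u' \<in> states A \<and> u \<in> delta A u' a \<longrightarrow>
        (\<exists>v'. (u', v') \<in> E \<and> v \<in> delta A v' a))"

text \<open>An explicit form of the coarsest forward-stable equivalence, which
  \<open>fs_equiv\<close> obtains only through a definite description.\<close>

definition greatest_bisim :: "('q, 'a) pre_nfa \<Rightarrow> 'q rel" where
  "greatest_bisim A = \<Union> {E. bisim A E}"

lemma bisimI:
  assumes "E \<subseteq> states A \<times> states A" "sym E"
    and "\<And>u v a u'. \<lbrakk>(u, v) \<in> E; a \<in> alphabet A; u' \<in> states A; u \<in> delta A u' a\<rbrakk>
      \<Longrightarrow> \<exists>v'. (u', v') \<in> E \<and> v \<in> delta A v' a"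
  shows "bisim A E"
  using assms unfolding bisim_def by blast

lemma bisim_subset: "bisim A E \<Longrightarrow> E \<subseteq> states A \<times> states A"
  unfolding bisim_def by blast

lemma bisim_lift:
  assumes "bisim A E" "(u, v) \<in> E" "a \<in> alphabet A" "u' \<in> states A" "u \<in> delta A u' a"
  obtains v' where "(u', v') \<in> E" "v \<in> delta A v' a"
  using assms unfolding bisim_def by blast

text \<open>Matching edges are passed along a chain of related states one link at a time. This
  yields transitivity of the greatest bisimulation.\<close>

lemma bisim_trancl:
  assumes E: "bisim A E"
  shows "bisim A (E\<^sup>+)"
proof (rule bisimI)
  show "E\<^sup>+ \<subseteq> states A \<times> states A"
    using bisim_subset[OF E] by (rule trancl_subset_Sigma)
  show "sym (E\<^sup>+)"
    using E unfolding bisim_def by (simp add: sym_trancl)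
next
  fix u v a u'
  assume "(u, v) \<in> E\<^sup>+" and a: "a \<in> alphabet A" and "u' \<in> states A" "u \<in> delta A u' a"
  then show "\<exists>v'. (u', v') \<in> E\<^sup>+ \<and> v \<in> delta A v' a"
  proof (induction rule: trancl_induct)
    case (base v)
    then show ?case using bisim_lift[OF E] by (metis r_into_trancl)
  next
    case (step v w)
    then obtain v' where v': "(u', v') \<in> E\<^sup>+" "v \<in> delta A v' a" by blast
    moreover have "v' \<in> states A"
      using v'(1) trancl_subset_Sigma[OF bisim_subset[OF E]] by blast
    ultimately obtain w' where "(v', w') \<in> E" "w \<in> delta A w' a"
      using bisim_lift[OF E step(2) a] by blast
    with v' show ?case by (meson trancl.trancl_into_trancl)
  qed
qed

lemma bisim_greatest_bisim: "bisim A (greatest_bisim A)"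
proof (rule bisimI)
  show "sym (greatest_bisim A)"
    unfolding greatest_bisim_def bisim_def sym_def by blast
qed (auto simp: greatest_bisim_def bisim_def, metis)

lemma bisim_subset_greatest_bisim: "bisim A E \<Longrightarrow> E \<subseteq> greatest_bisim A"
  unfolding greatest_bisim_def by blast

text \<open>Maximality does the work: the identity and the transitive closure are themselves
  bisimulations, hence contained in the greatest one.\<close>

lemma equiv_greatest_bisim: "equiv (states A) (greatest_bisim A)"
proof (rule equivI)
  show "greatest_bisim A \<subseteq> states A \<times> states A"
    by (rule bisim_subset[OF bisim_greatest_bisim])
  show "sym (greatest_bisim A)"
    using bisim_greatest_bisim[of A] unfolding bisim_def by blast
  have "bisim A (Id_on (states A))"
    by (rule bisimI) (auto simp: sym_Id_on)
  from bisim_subset_greatest_bisim[OF this] show "refl_on (states A) (greatest_bisim A)"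
    by (auto simp: refl_on_def)
  have "(greatest_bisim A)\<^sup>+ \<subseteq> greatest_bisim A"
    by (rule bisim_subset_greatest_bisim[OF bisim_trancl[OF bisim_greatest_bisim]])
  then show "trans (greatest_bisim A)"
    by (meson r_into_trancl subsetD trancl_trans transI)
qed

section \<open>Correspondence between bisimulations and forward-stable partitions\<close>

lemma forward_stable_partition_quotient:
  assumes eq: "equiv (states A) E" and E: "bisim A E"
  shows "forward_stable_partition A (states A // E)"
  unfolding forward_stable_partition_def
proof (intro conjI ballI)
  show "partition_on (states A) (states A // E)"
    by (rule partition_on_quotient[OF eq])
next
  fix S T assume S: "S \<in> states A // E" and T: "T \<in> states A // E"
  show "forward_stable A S T"
    unfolding forward_stable_def
  proof (intro ballI disjCI subsetI)
    fix a v assume a: "a \<in> alphabet A" and "S \<inter> step A a T \<noteq> {}" and v: "v \<in> S"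
    then obtain u u' where u: "u \<in> S" "u' \<in> T" "u \<in> delta A u' a"
      by (auto simp: step_def)
    \<comment> \<open>The edge into \<open>u\<close> is moved to the equivalent \<open>v\<close>;
      its new source is equivalent to \<open>u'\<close> and so stays in \<open>T\<close>.\<close>
    have "(u, v) \<in> E"
      using quotient_eq_iff[OF eq S S u(1) v] by simp
    moreover have "u' \<in> states A"
      using u(2) T eq by (meson in_quotient_imp_subset subsetD)
    ultimately obtain v' where v': "(u', v') \<in> E" "v \<in> delta A v' a"
      using bisim_lift[OF E] a u(3) by blast
    have "v' \<in> T" using in_quotient_imp_closed[OF eq T u(2) v'(1)] .
    with v' show "v \<in> step A a T" by (auto simp: step_def)
  qed
qed

text \<open>If \<open>u\<close> has an incoming edge from the part \<open>T\<close>,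
  forward-stability gives every state in the part of \<open>u\<close> one from \<open>T\<close> as
  well, which is the required match.\<close>

lemma bisim_forward_stable_partition:
  assumes P: "forward_stable_partition A P"
  shows "bisim A {(u, v). \<exists>S\<in>P. u \<in> S \<and> v \<in> S}" (is "bisim A ?E")
proof (rule bisimI)
  have un: "\<Union>P = states A"
    using P unfolding forward_stable_partition_def partition_on_def by blast
  then show "?E \<subseteq> states A \<times> states A" by blast
  show "sym ?E" by (auto simp: sym_def)
  fix u v a u'
  assume "(u, v) \<in> ?E" and a: "a \<in> alphabet A" and "u' \<in> states A" "u \<in> delta A u' a"
  moreover from this(3) un obtain T where "T \<in> P" "u' \<in> T" by blast
  ultimately obtain S T where ST: "S \<in> P" "T \<in> P"
    and mem: "u \<in> S" "v \<in> S" "u' \<in> T" "u \<in> step A a T"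
    unfolding step_def by blast
  from P ST have "forward_stable A S T"
    unfolding forward_stable_partition_def by blast
  with mem a have "v \<in> step A a T"
    unfolding forward_stable_def by blast
  with ST mem show "\<exists>v'. (u', v') \<in> ?E \<and> v \<in> delta A v' a"
    by (auto simp: step_def)
qed

text \<open>Any forward-stable partition induces a bisimulation, so each of its parts lies in one
  class of the greatest one. Antisymmetry of refinement gives uniqueness.\<close>

lemma coarsest_fs_partition_eq: "coarsest_fs_partition A = states A // greatest_bisim A"
proof -
  let ?M = "states A // greatest_bisim A"
  have fs: "forward_stable_partition A ?M"
    by (rule forward_stable_partition_quotient[OF equiv_greatest_bisim bisim_greatest_bisim])
  have coarsest: "refines (states A) P ?M" if P: "forward_stable_partition A P" for P
    unfolding refines_def
  proof (intro conjI ballI)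
    show part: "partition_on (states A) P"
      using P unfolding forward_stable_partition_def by blast
    show "partition_on (states A) ?M"
      using fs unfolding forward_stable_partition_def by blast
    fix S assume S: "S \<in> P"
    then obtain u where u: "u \<in> S" "u \<in> states A"
      using part unfolding partition_on_def by (metis UnionI all_not_in_conv)
    have "S \<subseteq> greatest_bisim A `` {u}"
      using bisim_subset_greatest_bisim[OF bisim_forward_stable_partition[OF P]] S u by blast
    with u show "\<exists>Y\<in>?M. S \<subseteq> Y" by (meson quotientI)
  qed
  show ?thesis
    unfolding coarsest_fs_partition_def
    by (rule the_equality) (use fs coarsest refines_asym in blast)+
qed

lemma fs_equiv_eq: "fs_equiv A = greatest_bisim A"
proof -
  let ?M = "greatest_bisim A"
  have "(u, v) \<in> ?M" if S: "S \<in> states A // ?M" and "u \<in> S" "v \<in> S" for u v S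
    using that quotient_eq_iff[OF equiv_greatest_bisim S S] by blast
  moreover have "\<exists>S\<in>states A // ?M. u \<in> S \<and> v \<in> S" if "(u, v) \<in> ?M" for u v
  proof -
    have "u \<in> states A" using that bisim_subset[OF bisim_greatest_bisim] by blast
    then show ?thesis
      using that quotientI equiv_class_self[OF equiv_greatest_bisim] by (metis Image_singleton_iff)
  qed
  ultimately show ?thesis
    unfolding fs_equiv_def coarsest_fs_partition_eq by auto
qed

section \<open>Maps that lift incoming edges\<close>

text \<open>The edge condition ranges over every \<open>u\<close> in a fibre, not just some
  representative: all states of a fibre have incoming edges from the same fibres. Closure of
  \<open>delta B\<close> is included so that \<open>B\<close> can be proved to be an NFA.\<close>

definition incoming_morphism ::
    "('p, 'a) pre_nfa \<Rightarrow> ('q, 'a) pre_nfa \<Rightarrow> ('p \<Rightarrow> 'q) \<Rightarrow> bool" where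
  "incoming_morphism C B f \<longleftrightarrow>
     f ` states C = states B \<and> alphabet B = alphabet C \<and> f (start C) = start B \<and>
     (\<forall>a\<in>alphabet C. \<forall>X\<in>states B. delta B X a \<subseteq> states B) \<and>
     (\<forall>a\<in>alphabet C. \<forall>u\<in>states C. \<forall>X\<in>states B.
        f u \<in> delta B X a \<longleftrightarrow> (\<exists>x\<in>states C. f x = X \<and> u \<in> delta C x a))"

lemma incoming_morphismD:
  assumes "incoming_morphism C B f"
  shows "f ` states C = states B" "alphabet B = alphabet C" "f (start C) = start B"
    and "\<lbrakk>a \<in> alphabet C; X \<in> states B\<rbrakk> \<Longrightarrow> delta B X a \<subseteq> states B"
    and "\<lbrakk>a \<in> alphabet C; u \<in> states C; X \<in> states B\<rbrakk>
      \<Longrightarrow> f u \<in> delta B X a \<longleftrightarrow> (\<exists>x\<in>states C. f x = X \<and> u \<in> delta C x a)"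
  using assms unfolding incoming_morphism_def by blast+

text \<open>Each state of \<open>C\<close> is some \<open>h u\<close>, and incoming edges in both
  \<open>C\<close> and \<open>B\<close> are read off from those of \<open>u\<close>. This compares
  two quotients of the same automaton.\<close>

lemma incoming_morphism_factor:
  assumes h: "incoming_morphism A C h" and g: "incoming_morphism A B g"
    and f: "\<And>u. u \<in> states A \<Longrightarrow> f (h u) = g u" and "start A \<in> states A"
  shows "incoming_morphism C B f"
  unfolding incoming_morphism_def
proof (intro conjI ballI)
  note h = incoming_morphismD[OF h] and g = incoming_morphismD[OF g]
  show "f ` states C = states B"
    using f by (simp flip: h(1) g(1) add: image_image)
  show "alphabet B = alphabet C" using h(2) g(2) by simp
  show "f (start C) = start B" using f assms(4) h(3) g(3) by metis
  show "delta B X a \<subseteq> states B" if "a \<in> alphabet C" "X \<in> states B" for a X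
    using that g(4) h(2) by blast
  fix a U X assume a: "a \<in> alphabet C" and "U \<in> states C" and X: "X \<in> states B"
  then obtain u where u: "u \<in> states A" "U = h u" using h(1) by blast
  have a': "a \<in> alphabet A" using a h(2) by simp
  have "f U \<in> delta B X a \<longleftrightarrow> (\<exists>x\<in>states A. f (h x) = X \<and> u \<in> delta A x a)"
    using g(5)[OF a' u(1) X] f u by auto
  also have "\<dots> \<longleftrightarrow> (\<exists>Y\<in>states C. f Y = X \<and> U \<in> delta C Y a)"
    using h(5)[OF a' u(1)] h(1) u(2) by (metis imageI)
  finally show "f U \<in> delta B X a \<longleftrightarrow> (\<exists>Y\<in>states C. f Y = X \<and> U \<in> delta C Y a)" .
qed

text \<open>A quotient edge into the class of \<open>u\<close> only guarantees an edge into some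
  equivalent \<open>v\<close>. The bisimulation moves it to \<open>u\<close>, keeping the source in
  the class \<open>X\<close>.\<close>

lemma incoming_morphism_quotient:
  assumes A: "nfa A" and eq: "equiv (states A) E" and E: "bisim A E"
  shows "incoming_morphism A (quotient_nfa A E) (\<lambda>u. E `` {u})"
  unfolding incoming_morphism_def
proof (intro conjI ballI)
  show "(\<lambda>u. E `` {u}) ` states A = states (quotient_nfa A E)"
    by (auto simp: quotient_nfa_def quotient_def)
  fix a u X assume a: "a \<in> alphabet A" and u: "u \<in> states A" and "X \<in> states (quotient_nfa A E)"
  then have X: "X \<in> states A // E" by (simp add: quotient_nfa_def)
  have "\<exists>x\<in>states A. E `` {x} = X \<and> u \<in> delta A x a"
    if x: "x \<in> X" and v: "(u, v) \<in> E" "v \<in> delta A x a" for x v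
  proof -
    have "(v, u) \<in> E" using v(1) eq by (meson equiv_def symD)
    moreover have "x \<in> states A" using X x eq by (meson in_quotient_imp_subset subsetD)
    ultimately obtain x' where x': "(x, x') \<in> E" "u \<in> delta A x' a"
      using bisim_lift[OF E _ a _ v(2)] by blast
    have "x' \<in> X" using in_quotient_imp_closed[OF eq X x x'(1)] .
    then have "E `` {x'} = X"
      using X eq by (metis Image_singleton_iff equiv_class_eq_iff quotientE)
    with x' bisim_subset[OF E] show ?thesis by blast
  qed
  moreover have "x \<in> E `` {x}" if "x \<in> states A" for x
    using equiv_class_self[OF eq that] .
  moreover have "E `` {u} \<in> states A // E" using u by (rule quotientI)
  ultimately show "E `` {u} \<in> delta (quotient_nfa A E) X a
      \<longleftrightarrow> (\<exists>x\<in>states A. E `` {x} = X \<and> u \<in> delta A x a)"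
    using u unfolding quotient_nfa_def by (auto, blast+)
qed (auto simp: quotient_nfa_def)

section \<open>Runs, languages and labels along such maps\<close>

lemma (in nfa) reach_subset_states: "w \<in> lists (alphabet A) \<Longrightarrow> reach A (start A) w \<subseteq> states A"
proof (induction w rule: rev_induct)
  case Nil
  then show ?case by (simp add: reach_def start_in_states)
next
  case (snoc a w)
  then show ?case using delta_closed by (fastforce simp: reach_def step_def)
qed

text \<open>A word reaching \<open>u\<close> is nonempty when \<open>u\<close> is not the start, and
  its last letter labels the edge.\<close>

lemma (in nfa) incoming_edge:
  assumes "u \<in> states A" "u \<noteq> start A"
  shows "\<exists>a\<in>alphabet A. \<exists>x\<in>states A. u \<in> delta A x a"
proof -
  obtain w where w: "w \<in> lists (alphabet A)" "u \<in> reach A (start A) w"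
    using all_reachable[OF assms(1)] by (auto simp: words_to_def)
  with assms(2) show ?thesis
  proof (cases w rule: rev_cases)
    case Nil
    with w assms(2) show ?thesis by (simp add: reach_def)
  next
    case (snoc w' a)
    with w have "u \<in> step A a (reach A (start A) w')" "w' \<in> lists (alphabet A)" "a \<in> alphabet A"
      by (auto simp: reach_def)
    with reach_subset_states show ?thesis by (fastforce simp: step_def)
  qed
qed

lemma (in nfa) incoming_morphism_start_iff:
  assumes f: "incoming_morphism A B f" and u: "u \<in> states A"
  shows "f u = start B \<longleftrightarrow> u = start A"
proof
  note f = incoming_morphismD[OF f]
  assume *: "f u = start B"
  show "u = start A"
  proof (rule ccontr)
    assume "u \<noteq> start A"
    then obtain a x where a: "a \<in> alphabet A" and x: "x \<in> states A" "u \<in> delta A x a"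
      using incoming_edge[OF u] by blast
    have X: "f x \<in> states B" using f(1) x(1) by blast
    \<comment> \<open>The edge from \<open>x\<close> into \<open>u\<close> maps to one into
      \<open>f u = f (start A)\<close>; lifting it back produces a forbidden edge into the start of
      \<open>A\<close>.\<close>
    have "f (start A) \<in> delta B (f x) a"
      using f(5)[OF a u X] x f(3) * by auto
    then obtain y where "y \<in> states A" "start A \<in> delta A y a"
      using f(5)[OF a start_in_states X] by blast
    with a start_no_incoming show False by blast
  qed
qed (use incoming_morphismD(3)[OF f] in simp)

lemma (in nfa) incoming_morphism_words_to:
  assumes f: "incoming_morphism A B f" and u: "u \<in> states A"
  shows "words_to B (f u) = words_to A u"
proof -
  note fD = incoming_morphismD[OF f]
  \<comment> \<open>Induction removes the last letter, since edges lift from their targets. The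
    inclusion is carried along because lifting is available only for sources in
    \<open>states B\<close>.\<close>
  have "reach B (start B) w \<subseteq> states B \<and>
      (\<forall>u\<in>states A. f u \<in> reach B (start B) w \<longleftrightarrow> u \<in> reach A (start A) w)"
    if "w \<in> lists (alphabet A)" for w
    using that
  proof (induction w rule: rev_induct)
    case Nil
    then show ?case
      using incoming_morphism_start_iff[OF f] imageI[OF start_in_states, of f] fD(1,3)
      by (auto simp: reach_def)
  next
    case (snoc a w)
    then have a: "a \<in> alphabet A" and w: "w \<in> lists (alphabet A)"
      and sub: "reach B (start B) w \<subseteq> states B"
      and IH: "\<And>u. u \<in> states A \<Longrightarrow> f u \<in> reach B (start B) w \<longleftrightarrow> u \<in> reach A (start A) w"
      by auto
    have stepB: "reach B (start B) (w @ [a]) = (\<Union>X\<in>reach B (start B) w. delta B X a)"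
      and stepA: "reach A (start A) (w @ [a]) = (\<Union>x\<in>reach A (start A) w. delta A x a)"
      by (simp_all add: reach_def step_def)
    have "f u \<in> reach B (start B) (w @ [a]) \<longleftrightarrow> u \<in> reach A (start A) (w @ [a])"
      if u: "u \<in> states A" for u
    proof
      assume "f u \<in> reach B (start B) (w @ [a])"
      then obtain X where X: "X \<in> reach B (start B) w" "f u \<in> delta B X a" using stepB by blast
      then obtain x where "x \<in> states A" "f x = X" "u \<in> delta A x a"
        using fD(5)[OF a u] sub by blast
      with X IH stepA show "u \<in> reach A (start A) (w @ [a])" by blast
    next
      assume "u \<in> reach A (start A) (w @ [a])"
      then obtain x where x: "x \<in> reach A (start A) w" "u \<in> delta A x a" using stepA by blast
      then have xs: "x \<in> states A" using reach_subset_states[OF w] by blast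
      then have "f u \<in> delta B (f x) a" using fD(5)[OF a u] fD(1) x by blast
      with x xs IH stepB show "f u \<in> reach B (start B) (w @ [a])" by blast
    qed
    moreover have "reach B (start B) (w @ [a]) \<subseteq> states B"
      using sub stepB fD(4)[OF a] by blast
    ultimately show ?case by blast
  qed
  then show ?thesis
    unfolding words_to_def using fD(2) u by auto
qed

lemma (in nfa) incoming_morphism_language:
  assumes "incoming_morphism A B f"
  shows "language B = language A"
proof -
  have "language B = (\<Union>u\<in>states A. words_to B (f u))"
    unfolding language_def by (simp flip: incoming_morphismD(1)[OF assms] add: image_image)
  also have "\<dots> = language A"
    unfolding language_def using incoming_morphism_words_to[OF assms] by simp
  finally show ?thesis .
qed

lemma (in nfa) nfa_incoming_morphism:
  assumes f: "incoming_morphism A B f"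
  shows "nfa B"
proof
  note fD = incoming_morphismD[OF f]
  show "finite (states B)" using fD(1) finite_states by (metis finite_imageI)
  show "finite (alphabet B)" using fD(2) finite_alphabet by simp
  show "start B \<in> states B" using fD(1,3) start_in_states by (metis imageI)
  show "delta B u a \<subseteq> states B" if "u \<in> states B" "a \<in> alphabet B" for u a
    using that fD(2,4) by simp
  show "words_to B U \<noteq> {}" if "U \<in> states B" for U
    using that fD(1) incoming_morphism_words_to[OF f] all_reachable by force
  show "start B \<notin> delta B X a" if "X \<in> states B" "a \<in> alphabet B" for X a
    using that fD(2,3) fD(5)[OF _ start_in_states, of a X] start_no_incoming by auto
  show "\<exists>X\<in>states B. delta B X a \<noteq> {}" if "a \<in> alphabet B" for a
  proof -
    have a: "a \<in> alphabet A" using that fD(2) by simp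
    then obtain x u where xu: "x \<in> states A" "u \<in> delta A x a" using alphabet_used by blast
    then have "u \<in> states A" using delta_closed a by blast
    with xu have "f u \<in> delta B (f x) a" using fD(5)[OF a] fD(1) by blast
    with fD(1) xu show ?thesis by blast
  qed
qed

lemma (in nfa) incoming_morphism_labels:
  assumes f: "incoming_morphism A B f" and u: "u \<in> states A"
  shows "labels B (f u) = labels A u"
proof -
  note fD = incoming_morphismD[OF f]
  have "(\<exists>X\<in>states B. f u \<in> delta B X a) \<longleftrightarrow> (\<exists>x\<in>states A. u \<in> delta A x a)"
    if "a \<in> alphabet A" for a
    using fD(5)[OF that u] fD(1) by blast
  then show ?thesis
    unfolding labels_def incoming_morphism_start_iff[OF f u] fD(2)
    by (intro if_cong refl arg_cong[where f = "image Some"] Collect_cong) blast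
qed

text \<open>An edge into \<open>u\<close> is pushed to \<open>B\<close>, matched there by
  \<open>E\<close>, and lifted to \<open>v\<close>. Thus a bisimulation on a quotient is bounded by
  the greatest one upstairs.\<close>

lemma bisim_vimage:
  assumes f: "incoming_morphism A B f" and E: "bisim B E"
  shows "bisim A {(u, v). u \<in> states A \<and> v \<in> states A \<and> (f u, f v) \<in> E}" (is "bisim A ?E")
proof (rule bisimI)
  note fD = incoming_morphismD[OF f]
  show "sym ?E" using E unfolding bisim_def sym_def by blast
  fix u v a u'
  assume uv: "(u, v) \<in> ?E" and a: "a \<in> alphabet A" and u': "u' \<in> states A" "u \<in> delta A u' a"
  have "f u \<in> delta B (f u') a" using fD(5)[OF a] fD(1) uv u' by blast
  then obtain V where V: "(f u', V) \<in> E" "f v \<in> delta B V a"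
    using bisim_lift[OF E] uv a fD(1,2) u'(1)
    by (metis (mono_tags, lifting) case_prodD imageI mem_Collect_eq)
  then have "V \<in> states B" using bisim_subset[OF E] by blast
  then obtain v' where "v' \<in> states A" "f v' = V" "v \<in> delta A v' a"
    using fD(5)[OF a] V uv by blast
  with V u' show "\<exists>v'. (u', v') \<in> ?E \<and> v \<in> delta A v' a" by blast
qed auto

section \<open>Co-lex relations and width\<close>

lemma colex_relationI:
  assumes "R \<subseteq> states A \<times> states A" "\<And>u. u \<in> states A \<Longrightarrow> (u, u) \<in> R"
    and "\<And>u v. \<lbrakk>u \<noteq> v; (u, v) \<in> R\<rbrakk> \<Longrightarrow> labels_le A u v"
    and "\<And>a u' v' u v. \<lbrakk>a \<in> alphabet A; u' \<in> states A; v' \<in> states A; u \<in> delta A u' a;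
      v \<in> delta A v' a; u \<noteq> v; (u, v) \<in> R\<rbrakk> \<Longrightarrow> (u', v') \<in> R"
  shows "colex_relation A R"
  using assms unfolding colex_relation_def refl_on_def by blast

lemma colex_relationD:
  assumes "colex_relation A R"
  shows "R \<subseteq> states A \<times> states A" "u \<in> states A \<Longrightarrow> (u, u) \<in> R"
    and "\<lbrakk>u \<noteq> v; (u, v) \<in> R\<rbrakk> \<Longrightarrow> labels_le A u v"
    and "\<lbrakk>a \<in> alphabet A; u' \<in> states A; v' \<in> states A; u \<in> delta A u' a;
      v \<in> delta A v' a; u \<noteq> v; (u, v) \<in> R\<rbrakk> \<Longrightarrow> (u', v') \<in> R"
  using assms unfolding colex_relation_def refl_on_def by blast+

text \<open>Each closure condition has only one related pair as premise, so it survives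
  unions.\<close>

lemma colex_relation_max_colex_relation: "colex_relation A (max_colex_relation A)"
proof (rule colex_relationI)
  have "colex_relation A (Id_on (states A))"
    by (rule colex_relationI) auto
  then show "(u, u) \<in> max_colex_relation A" if "u \<in> states A" for u
    unfolding max_colex_relation_def using that by blast
qed (auto simp: max_colex_relation_def dest: colex_relationD)

lemma colex_relation_subset_max: "colex_relation A R \<Longrightarrow> R \<subseteq> max_colex_relation A"
  unfolding max_colex_relation_def by blast

text \<open>By antisymmetry a related pair of distinct states is already a strict pair.\<close>

lemma colex_order_imp_relation:
  assumes "colex_order A r"
  shows "colex_relation A r"
proof -
  have po: "partial_order_on (states A) r"
    using assms unfolding colex_order_def by blast
  then have "(v, u) \<notin> r" if "u \<noteq> v" "(u, v) \<in> r" for u v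
    using that by (meson antisymD partial_order_onD(3))
  then show ?thesis
    using assms partial_order_onD[OF po] unfolding colex_order_def colex_relation_def by blast
qed

text \<open>The discrete order witnesses that the minimum in \<open>colex_width\<close> is taken
  over a nonempty set.\<close>

lemma colex_order_Id_on: "colex_order A (Id_on (states A))"
  unfolding colex_order_def partial_order_on_def preorder_on_def
  by (auto simp: refl_on_def trans_Id_on antisym_Id_on)

section \<open>Transitivity of the maximum co-lex relation\<close>

lemma (in nfa) labels_nonempty: "u \<in> states A \<Longrightarrow> labels A u \<noteq> {}"
proof (cases "u = start A")
  case False
  assume "u \<in> states A"
  with False obtain a x where "a \<in> alphabet A" "x \<in> states A" "u \<in> delta A x a"
    using incoming_edge by blast
  with False show ?thesis unfolding labels_def by auto
qed (simp add: labels_def)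

lemma labels_edge:
  assumes "a \<in> alphabet A" "x \<in> states A" "u \<in> delta A x a" "u \<noteq> start A"
  shows "Some a \<in> labels A u"
  using assms unfolding labels_def by auto

lemma (in nfa) edge_of_label:
  assumes "Some a \<in> labels A u"
  obtains x where "a \<in> alphabet A" "x \<in> states A" "u \<in> delta A x a"
  using assms unfolding labels_def by (auto split: if_splits)

lemma (in nfa) trans_max_colex_relation: "trans (max_colex_relation A)"
proof -
  let ?R = "max_colex_relation A"
  note R = colex_relationD[OF colex_relation_max_colex_relation[of A]]
  \<comment> \<open>By maximality it suffices that the composition is again a co-lex
    relation.\<close>
  have "colex_relation A (?R O ?R)"
  proof (rule colex_relationI)
    show "?R O ?R \<subseteq> states A \<times> states A" using R(1) by blast
    show "(u, u) \<in> ?R O ?R" if "u \<in> states A" for u using R(2)[OF that] by blast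
  next
    fix u w assume "u \<noteq> w" "(u, w) \<in> ?R O ?R"
    then obtain v where v: "(u, v) \<in> ?R" "(v, w) \<in> ?R" by blast
    \<comment> \<open>A label of the middle state is essential: with an empty label set the
      comparisons through \<open>v\<close> would hold vacuously.\<close>
    then obtain b where b: "b \<in> labels A v" using R(1) labels_nonempty by blast
    show "labels_le A u w"
    proof (cases "u = v \<or> v = w")
      case True
      then show ?thesis using R(3) \<open>u \<noteq> w\<close> v by blast
    next
      case False
      then have "labels_le A u v" "labels_le A v w" using R(3) v by blast+
      with b show ?thesis unfolding labels_le_def by (meson order_trans)
    qed
  next
    fix a u' w' u w
    assume a: "a \<in> alphabet A" and u': "u' \<in> states A" "u \<in> delta A u' a"
      and w': "w' \<in> states A" "w \<in> delta A w' a" and "u \<noteq> w" "(u, w) \<in> ?R O ?R"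
    then obtain v where v: "(u, v) \<in> ?R" "(v, w) \<in> ?R" by blast
    show "(u', w') \<in> ?R O ?R"
    proof (cases "u = v \<or> v = w")
      case True
      then have "(u', w') \<in> ?R" using R(4)[OF a u'(1) w'(1) u'(2) w'(2) \<open>u \<noteq> w\<close>] v by blast
      then show ?thesis using R(2)[OF u'(1)] by blast
    next
      case False
      have "u \<noteq> start A" "w \<noteq> start A" using start_no_incoming a u' w' by blast+
      then have lab: "Some a \<in> labels A u" "Some a \<in> labels A w"
        using labels_edge a u' w' by metis+
      have "v \<in> states A" using v R(1) by blast
      then obtain b where b: "b \<in> labels A v" using labels_nonempty by blast
      \<comment> \<open>The label of \<open>v\<close> is squeezed between two copies of
        \<open>a\<close>, so \<open>v\<close> has an incoming \<open>a\<close>-edge, whose source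
        \<open>v'\<close> links \<open>u'\<close> to \<open>w'\<close>.\<close>
      then have "b = Some a"
        using R(3)[OF _ v(1)] R(3)[OF _ v(2)] False lab unfolding labels_le_def
        by (meson order_antisym)
      with b obtain v' where v': "v' \<in> states A" "v \<in> delta A v' a"
        using edge_of_label by blast
      have "(u', v') \<in> ?R" using R(4)[OF a u'(1) v'(1) u'(2) v'(2)] False v by blast
      moreover have "(v', w') \<in> ?R" using R(4)[OF a v'(1) w'(1) v'(2) w'(2)] False v by blast
      ultimately show ?thesis by blast
    qed
  qed
  then have "?R O ?R \<subseteq> ?R" by (rule colex_relation_subset_max)
  then show ?thesis by (meson relcomp.relcompI subsetD transI)
qed

lemma equiv_induced_equiv:
  assumes "preorder_on X r"
  shows "equiv X (induced_equiv r)"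
proof (rule equivI)
  show "trans (induced_equiv r)"
    using assms unfolding preorder_on_def induced_equiv_def by (simp add: trans_Int)
qed (use assms in \<open>auto simp: preorder_on_def induced_equiv_def refl_on_def sym_def\<close>)

lemma (in nfa) preorder_max_colex_relation: "preorder_on (states A) (max_colex_relation A)"
  using colex_relationD(1,2)[OF colex_relation_max_colex_relation[of A]] trans_max_colex_relation
  unfolding preorder_on_def refl_on_def by blast

text \<open>
  Distinct states that are equivalent for the maximum co-lex relation carry one and the same label,
  and all their predecessors are equivalent to each other.
\<close>

lemma (in nfa) bisim_max_colex_relation: "bisim A (induced_equiv (max_colex_relation A))"
proof (rule bisimI)
  let ?R = "max_colex_relation A"
  note R = colex_relationD[OF colex_relation_max_colex_relation[of A]]
  show "induced_equiv ?R \<subseteq> states A \<times> states A" using R(1) unfolding induced_equiv_def by blast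
  show "sym (induced_equiv ?R)" unfolding induced_equiv_def sym_def by blast
  fix u v a u'
  assume uv: "(u, v) \<in> induced_equiv ?R" and a: "a \<in> alphabet A"
    and u': "u' \<in> states A" "u \<in> delta A u' a"
  show "\<exists>v'. (u', v') \<in> induced_equiv ?R \<and> v \<in> delta A v' a"
  proof (cases "u = v")
    case True
    then show ?thesis using R(2) u' unfolding induced_equiv_def by blast
  next
    case False
    have le: "(u, v) \<in> ?R" "(v, u) \<in> ?R" using uv unfolding induced_equiv_def by auto
    have "u \<noteq> start A" using start_no_incoming a u' by blast
    then have "Some a \<in> labels A u" using labels_edge a u' by metis
    moreover obtain b where b: "b \<in> labels A v" using labels_nonempty le(1) R(1) by blast
    ultimately have "b = Some a"
      using R(3)[OF False le(1)] R(3)[OF False[symmetric] le(2)] unfolding labels_le_def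
      by (meson order_antisym)
    with b obtain v' where v': "v' \<in> states A" "v \<in> delta A v' a"
      using edge_of_label by blast
    have "(u', v') \<in> ?R" "(v', u') \<in> ?R"
      using R(4)[OF a u'(1) v'(1) u'(2) v'(2)] R(4)[OF a v'(1) u'(1) v'(2) u'(2)] False le
      by auto
    with v' show ?thesis unfolding induced_equiv_def by blast
  qed
qed

text \<open>Edges into \<open>U\<close> and \<open>V\<close> lift to edges into the very
  representatives \<open>u\<close> and \<open>v\<close> that are related, and labels agree along
  \<open>f\<close>. Relations are used because an image may lose transitivity and
  antisymmetry.\<close>

lemma (in nfa) colex_relation_image:
  assumes f: "incoming_morphism A B f" and R: "colex_relation A R"
  shows "colex_relation B ((\<lambda>(u, v). (f u, f v)) ` R)" (is "colex_relation B ?R")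
proof (rule colex_relationI)
  note fD = incoming_morphismD[OF f] and R = colex_relationD[OF R]
  show "?R \<subseteq> states B \<times> states B" using R(1) fD(1) by auto
  show "(U, U) \<in> ?R" if "U \<in> states B" for U
    using that R(2) unfolding fD(1)[symmetric] by (auto intro: rev_image_eqI)
  show "labels_le B U V" if "U \<noteq> V" "(U, V) \<in> ?R" for U V
  proof -
    obtain u v where uv: "(u, v) \<in> R" "U = f u" "V = f v" using \<open>(U, V) \<in> ?R\<close> by auto
    moreover have "u \<in> states A" "v \<in> states A" using uv(1) R(1) by auto
    ultimately show ?thesis
      using R(3)[of u v] \<open>U \<noteq> V\<close> incoming_morphism_labels[OF f] unfolding labels_le_def by auto
  qed
  fix a X Y U V
  assume a: "a \<in> alphabet B" and XY: "X \<in> states B" "Y \<in> states B"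
    and UV: "U \<in> delta B X a" "V \<in> delta B Y a" "U \<noteq> V" and "(U, V) \<in> ?R"
  then obtain u v where uv: "(u, v) \<in> R" "U = f u" "V = f v" by auto
  have a': "a \<in> alphabet A" using a fD(2) by simp
  have mem: "u \<in> states A" "v \<in> states A" using uv(1) R(1) by auto
  obtain x where x: "x \<in> states A" "f x = X" "u \<in> delta A x a"
    using fD(5)[OF a' mem(1) XY(1)] UV(1) uv(2) by blast
  obtain y where y: "y \<in> states A" "f y = Y" "v \<in> delta A y a"
    using fD(5)[OF a' mem(2) XY(2)] UV(2) uv(3) by blast
  have "u \<noteq> v" using UV(3) uv by blast
  then have "(x, y) \<in> R" using R(4)[OF a' x(1) y(1) x(3) y(3)] uv(1) by blast
  with \<open>f x = X\<close> \<open>f y = Y\<close> show "(X, Y) \<in> ?R" by (auto intro: rev_image_eqI)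
qed

section \<open>Widths under maps and the co-lex width\<close>

lemma width_image_le:
  assumes fin: "finite X" and mono: "\<And>u v. (u, v) \<in> r \<Longrightarrow> (f u, f v) \<in> r'"
  shows "width (f ` X) r' \<le> width X r"
  unfolding width_def
proof (rule Max.boundedI)
  show "finite (card ` {S. S \<subseteq> f ` X \<and> antichain r' S})" using fin by simp
  show "card ` {S. S \<subseteq> f ` X \<and> antichain r' S} \<noteq> {}"
    by (auto simp: antichain_def)
  fix n assume "n \<in> card ` {S. S \<subseteq> f ` X \<and> antichain r' S}"
  then obtain S where S: "n = card S" "S \<subseteq> f ` X" "antichain r' S" by blast
  \<comment> \<open>One preimage is chosen per element of the antichain; a comparable pair among
    them would have comparable images.\<close>
  then obtain T where T: "T \<subseteq> X" "inj_on f T" "S = f ` T"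
    by (meson subset_image_inj)
  have "antichain r T"
    using S(3) T(2,3) mono unfolding antichain_def by (metis imageI inj_onD)
  moreover have "card T = n" using S(1) T(2,3) by (simp add: card_image)
  ultimately show "n \<le> Max (card ` {S. S \<subseteq> X \<and> antichain r S})"
    using T(1) fin by (intro Max_ge) auto
qed

lemma colex_width_attained:
  obtains r where "colex_order A r" "colex_width A = width (states A) r"
proof -
  have "\<exists>w r. colex_order A r \<and> w = width (states A) r"
    using colex_order_Id_on by blast
  then have "\<exists>r. colex_order A r \<and> colex_width A = width (states A) r"
    unfolding colex_width_def by (rule LeastI_ex)
  then show ?thesis using that by blast
qed

lemma colex_width_le: "colex_order A r \<Longrightarrow> colex_width A \<le> width (states A) r"
  unfolding colex_width_def by (rule Least_le) blast

text \<open>The image of a co-lex order of least width is a co-lex relation of \<open>B\<close>,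
  hence inside the maximum one, and antichains of the latter pull back.\<close>

lemma (in nfa) width_max_colex_relation_le:
  assumes f: "incoming_morphism A B f"
  shows "width (states B) (max_colex_relation B) \<le> colex_width A"
proof -
  obtain r where r: "colex_order A r" "colex_width A = width (states A) r"
    by (rule colex_width_attained)
  have "(f u, f v) \<in> max_colex_relation B" if "(u, v) \<in> r" for u v
    using colex_relation_subset_max[OF colex_relation_image[OF f colex_order_imp_relation[OF r(1)]]]
      that by auto
  then have "width (f ` states A) (max_colex_relation B) \<le> width (states A) r"
    by (intro width_image_le finite_states)
  with r(2) incoming_morphismD(1)[OF f] show ?thesis by simp
qed

section \<open>The quotient by the coarsest forward-stable partition\<close>

text \<open>Mutually related classes form a bisimulation of the quotient. Its pullback lies in the
  greatest bisimulation of \<open>A\<close>, so such classes coincide.\<close>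

lemma (in nfa) antisym_max_colex_relation_quotient:
  "antisym (max_colex_relation (quotient_nfa A (greatest_bisim A)))"
proof (rule antisymI)
  let ?M = "greatest_bisim A"
  let ?B = "quotient_nfa A ?M"
  fix X Y assume XY: "(X, Y) \<in> max_colex_relation ?B" "(Y, X) \<in> max_colex_relation ?B"
  have f: "incoming_morphism A ?B (\<lambda>u. ?M `` {u})"
    by (rule incoming_morphism_quotient[OF nfa_axioms equiv_greatest_bisim bisim_greatest_bisim])
  interpret B: nfa ?B by (rule nfa_incoming_morphism[OF f])
  have "X \<in> states ?B" "Y \<in> states ?B"
    using XY(1) colex_relationD(1)[OF colex_relation_max_colex_relation[of ?B]] by auto
  then obtain u v where uv: "u \<in> states A" "v \<in> states A" "X = ?M `` {u}" "Y = ?M `` {v}"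
    unfolding incoming_morphismD(1)[OF f, symmetric] by (elim imageE)
  then have "(u, v) \<in> {(u, v). u \<in> states A \<and> v \<in> states A \<and>
      (?M `` {u}, ?M `` {v}) \<in> induced_equiv (max_colex_relation ?B)}"
    using XY unfolding induced_equiv_def by simp
  then have "(u, v) \<in> ?M"
    using bisim_subset_greatest_bisim[OF bisim_vimage[OF f B.bisim_max_colex_relation]]
    by (rule rev_subsetD)
  from equiv_class_eq[OF equiv_greatest_bisim this] show "X = Y" using uv by simp
qed

lemma (in nfa) colex_order_max_colex_relation:
  assumes "antisym (max_colex_relation A)"
  shows "colex_order A (max_colex_relation A)"
proof -
  have "partial_order_on (states A) (max_colex_relation A)"
    using assms preorder_max_colex_relation unfolding partial_order_on_def by blast
  moreover note R = colex_relationD(3,4)[OF colex_relation_max_colex_relation[of A]]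
  have "labels_le A u v"
    if "(u, v) \<in> max_colex_relation A \<and> (v, u) \<notin> max_colex_relation A" for u v
    using that R(1) by metis
  moreover have "(u', v') \<in> max_colex_relation A"
    if "a \<in> alphabet A" "u' \<in> states A" "v' \<in> states A" "u \<in> delta A u' a" "v \<in> delta A v' a"
      "(u, v) \<in> max_colex_relation A \<and> (v, u) \<notin> max_colex_relation A" for a u' v' u v
    using that R(2) by metis
  ultimately show ?thesis
    unfolding colex_order_def by blast
qed

text \<open>Every co-lex order lies in the maximum relation, which under antisymmetry is itself a
  co-lex order.\<close>

lemma (in nfa) max_colex_order_eq:
  assumes "antisym (max_colex_relation A)"
  shows "max_colex_order A = max_colex_relation A"
proof -
  have "max_colex_relation A = \<Union> {r. colex_order A r}"
    using colex_order_max_colex_relation[OF assms] colex_relation_subset_max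
      colex_order_imp_relation by blast
  then show ?thesis
    unfolding max_colex_order_def is_max_colex_order_def
    using colex_order_max_colex_relation[OF assms] by (intro the_equality) auto
qed

lemma incoming_morphism_id: "nfa A \<Longrightarrow> incoming_morphism A A (\<lambda>u. u)"
  unfolding incoming_morphism_def by (auto dest: nfa.delta_closed)

text \<open>The maximum relation is a candidate order, and the identity morphism shows that no order
  has smaller width.\<close>

lemma (in nfa) colex_width_eq:
  assumes "antisym (max_colex_relation A)"
  shows "colex_width A = width (states A) (max_colex_relation A)"
  using colex_width_le[OF colex_order_max_colex_relation[OF assms]]
    width_max_colex_relation_le[OF incoming_morphism_id[OF nfa_axioms]] by (rule order_antisym)

section \<open>Assembling the three claims\<close>

theorem theorem1:
  fixes A :: "('q, 'a::linorder) pre_nfa"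
  assumes "nfa A"
  shows "indexable A (cfs_order A)
    \<and> colex_width (quotient_nfa A (induced_equiv (cfs_order A)))
        \<le> colex_width (quotient_nfa A (induced_equiv (max_colex_relation A)))
    \<and> card (states A // induced_equiv (cfs_order A))
        \<le> card (states A // induced_equiv (max_colex_relation A))"
proof -
  interpret nfa A by (rule assms)
  define M where "M = greatest_bisim A"
  define B where "B = quotient_nfa A M"
  define L where "L = max_colex_relation B"
  define E where "E = induced_equiv (max_colex_relation A)"
  have eqM: "equiv (states A) M" and "bisim A M"
    unfolding M_def by (rule equiv_greatest_bisim, rule bisim_greatest_bisim)
  then have f: "incoming_morphism A B (\<lambda>u. M `` {u})"
    unfolding B_def by (intro incoming_morphism_quotient assms)
  note fD = incoming_morphismD[OF f]
  interpret B: nfa B by (rule nfa_incoming_morphism[OF f])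
  have anti: "antisym (max_colex_relation B)"
    unfolding B_def M_def by (rule antisym_max_colex_relation_quotient)
  have orderL: "colex_order B L" unfolding L_def by (rule B.colex_order_max_colex_relation[OF anti])
  have widthB: "colex_width B = width (states B) L"
    unfolding L_def by (rule B.colex_width_eq[OF anti])
  have preL: "preorder_on (states B) L"
    unfolding L_def by (rule B.preorder_max_colex_relation)

  have cfs: "cfs_order A = {(u, v). u \<in> states A \<and> v \<in> states A \<and> (M `` {u}, M `` {v}) \<in> L}"
    unfolding cfs_order_def fs_equiv_eq L_def B_def M_def
    using B.max_colex_order_eq[OF anti] unfolding B_def M_def by simp
  have classes: "M `` {u} \<in> states B" if "u \<in> states A" for u
    using fD(1) that by blast
  have pre: "preorder_on (states A) (cfs_order A)"
    unfolding preorder_on_def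
  proof (intro conjI)
    show "refl_on (states A) (cfs_order A)"
      using preL classes unfolding cfs preorder_on_def refl_on_def by blast
    show "trans (cfs_order A)"
      using preL unfolding cfs preorder_on_def trans_def by blast
  qed (auto simp: cfs)
  \<comment> \<open>Antisymmetry of \<open>L\<close> gives one inclusion, its reflexivity the
    other.\<close>
  have ind: "induced_equiv (cfs_order A) = M"
  proof (intro set_eqI iffI; clarify)
    fix u v assume "(u, v) \<in> induced_equiv (cfs_order A)"
    then have "u \<in> states A" "v \<in> states A" "M `` {u} = M `` {v}"
      using anti unfolding induced_equiv_def cfs L_def by (auto dest: antisymD)
    then show "(u, v) \<in> M" using eq_equiv_class[OF _ eqM] by blast
  next
    fix u v assume uv: "(u, v) \<in> M"
    then have "u \<in> states A" "v \<in> states A" "M `` {u} = M `` {v}"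
      using eqM equiv_class_eq[OF eqM uv] unfolding equiv_def by auto
    then show "(u, v) \<in> induced_equiv (cfs_order A)"
      using preL classes unfolding induced_equiv_def cfs preorder_on_def refl_on_def by auto
  qed
  have "induced_order (cfs_order A) = L"
  proof -
    have "(X, Y) \<in> induced_order (cfs_order A)" if XY: "(X, Y) \<in> L" for X Y
    proof -
      have "X \<in> states B" "Y \<in> states B" using preL XY unfolding preorder_on_def by auto
      then obtain u v where uv: "u \<in> states A" "v \<in> states A" "X = M `` {u}" "Y = M `` {v}"
        unfolding fD(1)[symmetric] by (elim imageE)
      with XY have "(u, v) \<in> cfs_order A" unfolding cfs by simp
      with uv(3,4) show ?thesis unfolding induced_order_def ind by blast
    qed
    then show ?thesis unfolding induced_order_def ind by (auto simp: cfs)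
  qed
  moreover have "language A = language B" using incoming_morphism_language[OF f] by simp
  moreover have "colex_width B \<le> colex_width A"
    using width_max_colex_relation_le[OF f] widthB unfolding L_def by simp
  ultimately have 1: "indexable A (cfs_order A)"
    unfolding indexable_def ind B_def[symmetric] using pre orderL widthB by simp

  have eqE: "equiv (states A) E" and bisimE: "bisim A E"
    unfolding E_def
    by (rule equiv_induced_equiv[OF preorder_max_colex_relation], rule bisim_max_colex_relation)
  have "E \<subseteq> M" unfolding M_def by (rule bisim_subset_greatest_bisim[OF bisimE])
  \<comment> \<open>As \<open>E\<close> refines \<open>M\<close>, taking \<open>M\<close>-images
    sends each \<open>E\<close>-class to the \<open>M\<close>-class containing it; this is the map
    between the two quotients.\<close>
  then have coarser: "M `` (E `` {u}) = M `` {u}" if "u \<in> states A" for u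
    using eqM equiv_class_self[OF eqE that] unfolding equiv_def trans_def by blast

  have h: "incoming_morphism A (quotient_nfa A E) (\<lambda>u. E `` {u})"
    by (rule incoming_morphism_quotient[OF assms eqE bisimE])
  interpret C: nfa "quotient_nfa A E" by (rule nfa_incoming_morphism[OF h])
  have "incoming_morphism (quotient_nfa A E) B (\<lambda>U. M `` U)"
    by (rule incoming_morphism_factor[OF h f coarser start_in_states])
  then have 2: "colex_width B \<le> colex_width (quotient_nfa A E)"
    using C.width_max_colex_relation_le widthB unfolding L_def by simp

  \<comment> \<open>The same map is onto the \<open>M\<close>-classes, so there are at most as many
    of them as \<open>E\<close>-classes.\<close>
  have "states A // M = (\<lambda>U. M `` U) ` (states A // E)"
    using coarser unfolding quotient_def by (auto simp: image_iff)
  moreover have "finite (states A // E)"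
    using finite_states eqE by (simp add: equiv_def finite_quotient)
  ultimately have 3: "card (states A // M) \<le> card (states A // E)"
    by (simp add: card_image_le)
  show ?thesis using 1 2 3 unfolding ind B_def E_def by blast
qed

end
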